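(* Let $\mathcal{E}$ be the set of all matrices $R\in Sl(\mathbb{Z},3)$ such that $RC_1\subset C_1$, $R^{-1}C_2\subset C_2$ and $RC_3\subset C_3$, where $$C_1=\{(x,y,z)^\top\in\mathbb{R}^3: 0\le x,\ 0\le y,\ 0\le z\le x+y\},$$ $$C_2=\{(x,y,z)^\top\in\mathbb{R}^3: 0\le x,\ 0\ge y,\ y\le z\le x\},$$ $$C_3=\{(0,0,z)^\top\in\mathbb{R}^3: 0\le z\}.$$ Then the monoid $\mathcal{E}$ coincides with $\mathcal{R}(\mathcal{M})=\langle R_G,R_{\widetilde G},R_D,R_{\widetilde D}\rangle$, the submonoid of $3\times 3$ matrices (under multiplication) generated by the four matrices $R_G,R_{\widetilde G},R_D,R_{\widetilde D}$.
   Context: $Sl(\mathbb{Z},3)=\{R\in\mathbb{Z}^{3\times3}:\det R=1\}$. Let $G,\widetilde G,D,\widetilde D$ be the morphisms of the free monoid $\{0,1\}^*$ given by $G:0\mapsto 0,\,1\mapsto 01$; $\widetilde G:0\mapsto 0,\,1\mapsto 10$; $D:0\mapsto 10,\,1\mapsto 1$; $\widetilde D:0\mapsto 01,\,1\mapsto 1$. The special Sturmian monoid is $\mathcal{M}=\langle G,\widetilde G,D,\widetilde D\rangle$, the monoid they generate under composition (including the identity). Put $$R_{\widetilde G}=\begin{pmatrix}1&1&0\\0&1&0\\0&1&1\end{pmatrix},\quad R_G=\begin{pmatrix}1&1&0\\0&1&0\\0&0&1\end{pmatrix},\quad R_{\widetilde D}=\begin{pmatrix}1&0&0\\1&1&0\\0&0&1\end{pmatrix},\quad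 R_D=\begin{pmatrix}1&0&0\\1&1&0\\1&0&1\end{pmatrix}.$$ For $\psi=\varphi_1\circ\cdots\circ\varphi_n\in\mathcal{M}$ with $\varphi_i\in\{G,\widetilde G,D,\widetilde D\}$, define $\mathcal{R}(\psi)=R_{\varphi_1}R_{\varphi_2}\cdots R_{\varphi_n}$ (identity matrix if $n=0$); this does not depend on the chosen decomposition of $\psi$. *)

theory Defs
  imports "HOL-Analysis.Analysis"
begin

inductive_set generated_monoid :: "('a \<Rightarrow> 'a \<Rightarrow> 'a) \<Rightarrow> 'a \<Rightarrow> 'a set \<Rightarrow> 'a set"
  for mult :: "'a \<Rightarrow> 'a \<Rightarrow> 'a" and unit :: 'a and S :: "'a set"
where
  unit: "unit \<in> generated_monoid mult unit S"
| incl: "x \<in> S \<Longrightarrow> x \<in> generated_monoid mult unit S"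
| mult: "x \<in> generated_monoid mult unit S \<Longrightarrow> y \<in> generated_monoid mult unit S
           \<Longrightarrow> mult x y \<in> generated_monoid mult unit S"


subsection \<open>Special Sturmian morphisms\<close>

datatype letter = L0 | L1

type_synonym word = "letter list"

definition morphism :: "word \<Rightarrow> word \<Rightarrow> word \<Rightarrow> word" where
  "morphism u v w = concat (map (\<lambda>a. case a of L0 \<Rightarrow> u | L1 \<Rightarrow> v) w)"

definition mor_G :: "word \<Rightarrow> word" where "mor_G = morphism [L0] [L0, L1]"
definition mor_Gt :: "word \<Rightarrow> word" where "mor_Gt = morphism [L0] [L1, L0]"
definition mor_D :: "word \<Rightarrow> word" where "mor_D = morphism [L1, L0] [L1]"
definition mor_Dt :: "word \<Rightarrow> word" where "mor_Dt = morphism [L0, L1] [L1]"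

definition special_sturmian :: "(word \<Rightarrow> word) set" where
  "special_sturmian = generated_monoid (\<circ>) id {mor_G, mor_Gt, mor_D, mor_Dt}"


subsection \<open>The matrix representation\<close>

text \<open>In \<^const>\<open>vector\<close> of vectors, the inner vectors are the rows.\<close>

definition R_G :: "int^3^3" where
  "R_G = vector [vector [1, 1, 0], vector [0, 1, 0], vector [0, 0, 1]]"
definition R_Gt :: "int^3^3" where
  "R_Gt = vector [vector [1, 1, 0], vector [0, 1, 0], vector [0, 1, 1]]"
definition R_D :: "int^3^3" where
  "R_D = vector [vector [1, 0, 0], vector [1, 1, 0], vector [1, 0, 1]]"
definition R_Dt :: "int^3^3" where
  "R_Dt = vector [vector [1, 0, 0], vector [1, 1, 0], vector [0, 0, 1]]"

datatype gen = G | Gt | D | Dt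

fun gen_mor :: "gen \<Rightarrow> word \<Rightarrow> word" where
  "gen_mor G = mor_G"
| "gen_mor Gt = mor_Gt"
| "gen_mor D = mor_D"
| "gen_mor Dt = mor_Dt"

fun gen_mat :: "gen \<Rightarrow> int^3^3" where
  "gen_mat G = R_G"
| "gen_mat Gt = R_Gt"
| "gen_mat D = R_D"
| "gen_mat Dt = R_Dt"

definition comp_gens :: "gen list \<Rightarrow> word \<Rightarrow> word" where
  "comp_gens gs = foldr (\<circ>) (map gen_mor gs) id"

definition prod_gens :: "gen list \<Rightarrow> int^3^3" where
  "prod_gens gs = foldr (**) (map gen_mat gs) (mat 1)"

text \<open>
  The matrix of a special Sturmian morphism; for arguments outside
  \<^const>\<open>special_sturmian\<close> the value is unspecified. Independence of the chosen
  decomposition, which makes the definite description meaningful, is shown below.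
\<close>

definition rep :: "(word \<Rightarrow> word) \<Rightarrow> int^3^3" where
  "rep \<psi> = (THE R. \<exists>gs. \<psi> = comp_gens gs \<and> R = prod_gens gs)"

text \<open>
  Well-definedness: each \<open>R\<^sub>\<phi>\<close> describes the action of \<open>\<phi>\<close> on the vector consisting of
  the two letter counts of a word and a suitably weighted count of its inversions.
\<close>

fun weight :: "word \<Rightarrow> real" where
  "weight [] = 0"
| "weight (L0 # w) = weight w + 1/2 - count_list w L1 / 2"
| "weight (L1 # w) = weight w + 1/2 + count_list w L0 / 2"

definition word_vec :: "word \<Rightarrow> real^3" where
  "word_vec w = vector [real (count_list w L0), real (count_list w L1), weight w]"

lemma mor_simps:
  "mor_G [] = []" "mor_G (L0 # w) = L0 # mor_G w" "mor_G (L1 # w) = L0 # L1 # mor_G w"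
  "mor_Gt [] = []" "mor_Gt (L0 # w) = L0 # mor_Gt w" "mor_Gt (L1 # w) = L1 # L0 # mor_Gt w"
  "mor_D [] = []" "mor_D (L0 # w) = L1 # L0 # mor_D w" "mor_D (L1 # w) = L1 # mor_D w"
  "mor_Dt [] = []" "mor_Dt (L0 # w) = L0 # L1 # mor_Dt w" "mor_Dt (L1 # w) = L1 # mor_Dt w"
  by (simp_all add: mor_G_def mor_Gt_def mor_D_def mor_Dt_def morphism_def)

lemma word_vec_gen:
  "word_vec (gen_mor g w) = map_matrix real_of_int (gen_mat g) *v word_vec w"
proof -
  have "count_list (gen_mor g w) L0 =
          count_list w L0 + (if g \<in> {G, Gt} then count_list w L1 else 0) \<and>
        count_list (gen_mor g w) L1 =
          count_list w L1 + (if g \<in> {D, Dt} then count_list w L0 else 0) \<and>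
        weight (gen_mor g w) =
          weight w + (if g = Gt then count_list w L1 else if g = D then count_list w L0 else 0)"
    by (induction w rule: weight.induct; cases g)
       (simp_all add: mor_simps field_simps)
  then show ?thesis
    by (cases g)
       (simp_all add: word_vec_def vec_eq_iff forall_3 matrix_vector_mult_def sum_3
          R_G_def R_Gt_def R_D_def R_Dt_def)
qed

lemma map_matrix_of_int_mult:
  "map_matrix real_of_int (A ** B) = map_matrix real_of_int A ** map_matrix real_of_int (B :: int^3^3)"
  by (simp add: vec_eq_iff matrix_matrix_mult_def)

lemma word_vec_comp_gens:
  "word_vec (comp_gens gs w) = map_matrix real_of_int (prod_gens gs) *v word_vec w"
proof (induction gs)
  case Nil
  have "map_matrix real_of_int (mat 1 :: int^3^3) = mat 1"
    by (simp add: vec_eq_iff mat_def)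
  then show ?case by (simp add: comp_gens_def prod_gens_def)
next
  case (Cons g gs)
  then show ?case
    by (simp add: comp_gens_def prod_gens_def word_vec_gen map_matrix_of_int_mult
        matrix_vector_mul_assoc)
qed

lemma prod_gens_unique:
  assumes "comp_gens gs = comp_gens hs"
  shows "prod_gens gs = prod_gens hs"
proof -
  have eq: "map_matrix real_of_int (prod_gens gs) *v word_vec w =
        map_matrix real_of_int (prod_gens hs) *v word_vec w" for w
    using assms by (metis word_vec_comp_gens)
  show ?thesis
    using eq[of "[L0]"] eq[of "[L1]"] eq[of "[L0, L1]"]
    by (simp add: vec_eq_iff forall_3 matrix_vector_mult_def sum_3 word_vec_def)
qed

lemma rep_comp_gens: "rep (comp_gens gs) = prod_gens gs"
  unfolding rep_def by (rule the_equality) (auto dest: prod_gens_unique)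


subsection \<open>The cones and the monoid of matrices preserving them\<close>

definition SL3_int :: "(int^3^3) set" where
  "SL3_int = {R. det R = 1}"

definition C1 :: "(real^3) set" where
  "C1 = {vector [x, y, z] | x y z. 0 \<le> x \<and> 0 \<le> y \<and> 0 \<le> z \<and> z \<le> x + y}"

definition C2 :: "(real^3) set" where
  "C2 = {vector [x, y, z] | x y z. 0 \<le> x \<and> 0 \<ge> y \<and> y \<le> z \<and> z \<le> x}"

definition C3 :: "(real^3) set" where
  "C3 = {vector [0, 0, z] | z. 0 \<le> z}"

abbreviation real_mat :: "int^3^3 \<Rightarrow> real^3^3" where
  "real_mat \<equiv> map_matrix real_of_int"

definition cone_monoid :: "(int^3^3) set" where
  "cone_monoid = {R \<in> SL3_int.
     (*v) (real_mat R) ` C1 \<subseteq> C1 \<and>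
     (*v) (matrix_inv (real_mat R)) ` C2 \<subseteq> C2 \<and>
     (*v) (real_mat R) ` C3 \<subseteq> C3}"

end

theory Submission
  imports Defs
begin

text \<open>
  Preserving \<open>C\<^sub>3\<close> together with \<open>det R = 1\<close> forces the last column of \<open>R\<close> to be \<open>(0,0,1)\<close>, and testing
  the cones \<open>C\<^sub>1\<close> and \<open>C\<^sub>2\<close> on their four extreme rays turns membership in \<open>\<E>\<close> into integer
  inequalities for the remaining entries, with \<open>a * d - b * c = 1\<close> and \<open>a, b, c, d \<ge> 0\<close>.
  Such a matrix \<open>R\<close> is descended by the Euclidean algorithm: unless the upper left block is the
  identity, one of its two rows dominates the other and may be subtracted from it. Whether this
  row also has to be subtracted from the third row (\<open>Gt\<close>, \<open>D\<close>) or not (\<open>G\<close>, \<open>Dt\<close>) is decided by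
  the size of the third row; the inequalities ensure that one of the two choices stays in \<open>\<E>\<close>.
\<close>

definition block_mat :: "'a \<Rightarrow> 'a \<Rightarrow> 'a \<Rightarrow> 'a \<Rightarrow> 'a \<Rightarrow> 'a \<Rightarrow> ('a::zero_neq_one)^3^3" where
  "block_mat a b c d e f = vector [vector [a, b, 0], vector [c, d, 0], vector [e, f, 1]]"

text \<open>The bounds on \<open>e\<close> and \<open>f\<close> come from the rays (1,0,0), (0,1,0),
  (1,0,1), (0,1,1) of \<open>C1\<close>, those in the last line from (1,0,0), (1,0,1), (0,-1,0),
  (0,-1,-1) of \<open>C2\<close> under the inverse. A bound is strict where the third coordinate of
  the ray contributes 1 or -1.\<close>

definition admissible :: "int \<Rightarrow> int \<Rightarrow> int \<Rightarrow> int \<Rightarrow> int \<Rightarrow> int \<Rightarrow> bool" where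
  "admissible a b c d e f \<longleftrightarrow>
     0 \<le> a \<and> 0 \<le> b \<and> 0 \<le> c \<and> 0 \<le> d \<and> a * d - b * c = 1 \<and>
     0 \<le> e \<and> e < a + c \<and> 0 \<le> f \<and> f < b + d \<and>
     - d < e * d - f * c \<and> e * d - f * c \<le> c \<and> - a < f * a - e * b \<and> f * a - e * b \<le> b"

subsection \<open>The cone monoid in coordinates\<close>

lemma mem_C1_iff: "v \<in> C1 \<longleftrightarrow> 0 \<le> v$1 \<and> 0 \<le> v$2 \<and> 0 \<le> v$3 \<and> v$3 \<le> v$1 + v$2"
  by (auto simp: C1_def vec_eq_iff forall_3)

lemma mem_C2_iff: "v \<in> C2 \<longleftrightarrow> 0 \<le> v$1 \<and> v$2 \<le> 0 \<and> v$2 \<le> v$3 \<and> v$3 \<le> v$1"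
  by (auto simp: C2_def vec_eq_iff forall_3)

lemma mem_C3_iff: "v \<in> C3 \<longleftrightarrow> v$1 = 0 \<and> v$2 = 0 \<and> 0 \<le> v$3"
  by (auto simp: C3_def vec_eq_iff forall_3)

lemma block_mat_nth:
  "block_mat a b c d e f $ 1 $ 1 = a" "block_mat a b c d e f $ 1 $ 2 = b"
  "block_mat a b c d e f $ 1 $ 3 = 0" "block_mat a b c d e f $ 2 $ 1 = c"
  "block_mat a b c d e f $ 2 $ 2 = d" "block_mat a b c d e f $ 2 $ 3 = 0"
  "block_mat a b c d e f $ 3 $ 1 = e" "block_mat a b c d e f $ 3 $ 2 = f"
  "block_mat a b c d e f $ 3 $ 3 = 1"
  by (simp_all add: block_mat_def)

lemma block_mat_vec:
  fixes a b c d e f :: "'a::comm_ring_1"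
  shows "(block_mat a b c d e f *v v) $ 1 = a * v$1 + b * v$2"
    "(block_mat a b c d e f *v v) $ 2 = c * v$1 + d * v$2"
    "(block_mat a b c d e f *v v) $ 3 = e * v$1 + f * v$2 + v$3"
  by (simp_all add: matrix_vector_mult_def sum_3 block_mat_nth)

lemma block_mat_mult:
  fixes a b c d e f :: "'a::comm_ring_1"
  shows "block_mat a b c d e f ** block_mat a' b' c' d' e' f' =
    block_mat (a * a' + b * c') (a * b' + b * d') (c * a' + d * c') (c * b' + d * d')
      (e * a' + f * c' + e') (e * b' + f * d' + f')"
  by (simp add: vec_eq_iff forall_3 matrix_matrix_mult_def sum_3 block_mat_nth)

lemma block_mat_one: "block_mat 1 0 0 1 0 0 = (mat 1 :: 'a::comm_ring_1^3^3)"
  by (simp add: vec_eq_iff forall_3 mat_def block_mat_nth)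

lemma real_block_mat:
  "real_mat (block_mat a b c d e f) =
     block_mat (of_int a) (of_int b) (of_int c) (of_int d) (of_int e) (of_int f)"
  by (simp add: vec_eq_iff forall_3 block_mat_nth)

lemma det_block_mat: "det (block_mat a b c d e f) = a * d - b * (c :: 'a::comm_ring_1)"
  by (simp add: det_3 block_mat_nth)

lemma matrix_inv_block_mat:
  fixes a b c d e f :: "'a::field"
  assumes det: "a * d - b * c = 1"
  shows "matrix_inv (block_mat a b c d e f) =
    block_mat d (- b) (- c) a (f * c - e * d) (e * b - f * a)" (is "matrix_inv ?A = ?B")
proof -
  have "d * a - b * c = 1" "(f * c - e * d) * a + (e * b - f * a) * c + e = 0"
    "(f * c - e * d) * b + (e * b - f * a) * d + f = 0"
    using det by algebra+
  then have left: "?B ** ?A = mat 1"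
    by (simp add: block_mat_mult mult.commute flip: block_mat_one)
  then have "?A ** ?B = mat 1 \<and> ?B ** ?A = mat 1"
    by (simp add: matrix_left_right_inverse)
  \<comment> \<open>\<open>matrix_inv\<close> is a choice; since \<open>?B\<close> is a two-sided
    inverse, the chosen matrix is one too.\<close>
  then have "?A ** matrix_inv ?A = mat 1 \<and> matrix_inv ?A ** ?A = mat 1"
    unfolding matrix_inv_def by (rule someI)
  then have right: "?A ** matrix_inv ?A = mat 1" ..
  have "matrix_inv ?A = (?B ** ?A) ** matrix_inv ?A" by (simp add: left)
  also have "\<dots> = ?B" using right by (simp flip: matrix_mul_assoc)
  finally show ?thesis .
qed

lemma block_mat_mem_cone_monoid_iff:
  "block_mat a b c d e f \<in> cone_monoid \<longleftrightarrow> admissible a b c d e f"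
proof
  let ?R = "real_mat (block_mat a b c d e f)"
  assume "block_mat a b c d e f \<in> cone_monoid"
  then have det: "a * d - b * c = 1"
    and C1: "\<And>v. v \<in> C1 \<Longrightarrow> ?R *v v \<in> C1"
    and C2: "\<And>v. v \<in> C2 \<Longrightarrow> matrix_inv ?R *v v \<in> C2"
    by (auto simp: cone_monoid_def SL3_int_def det_block_mat)
  have detr: "real_of_int a * of_int d - of_int b * of_int c = 1"
    using det by (metis of_int_1 of_int_diff of_int_mult)
  have C1': "\<And>(x::real) (y::real) (z::real). 0 \<le> x \<Longrightarrow> 0 \<le> y \<Longrightarrow> 0 \<le> z \<Longrightarrow> z \<le> x + y \<Longrightarrow>
    0 \<le> a * x + b * y \<and> 0 \<le> c * x + d * y \<and> 0 \<le> e * x + f * y + z \<and>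
      e * x + f * y + z \<le> a * x + b * y + (c * x + d * y)"
    using C1[of "vector [_, _, _]"] by (simp add: mem_C1_iff real_block_mat block_mat_vec)
  have C2': "\<And>(x::real) (y::real) (z::real). 0 \<le> x \<Longrightarrow> y \<le> 0 \<Longrightarrow> y \<le> z \<Longrightarrow> z \<le> x \<Longrightarrow>
    0 \<le> d * x - b * y \<and> a * y - c * x \<le> 0 \<and>
      a * y - c * x \<le> (f * c - e * d) * x + (e * b - f * a) * y + z \<and>
      (f * c - e * d) * x + (e * b - f * a) * y + z \<le> d * x - b * y"
    using C2[of "vector [_, _, _]"]
    by (simp add: mem_C2_iff real_block_mat matrix_inv_block_mat[OF detr] block_mat_vec)
  have "0 \<le> a" "0 \<le> c" "0 \<le> e" using C1'[of 1 0 0] by simp_all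
  moreover have "0 \<le> b" "0 \<le> d" "0 \<le> f" using C1'[of 0 1 0] by simp_all
  \<comment> \<open>Each side sits inside one \<open>real_of_int\<close>, so the comparison
    transfers to the integers, where it becomes strict.\<close>
  moreover have "real_of_int (e + 1) \<le> of_int (a + c)" using C1'[of 1 0 1] by simp
  moreover have "real_of_int (f + 1) \<le> of_int (b + d)" using C1'[of 0 1 1] by simp
  moreover have "real_of_int (- c) \<le> of_int (f * c - e * d)" using C2'[of 1 0 0] by simp
  moreover have "real_of_int (f * c - e * d + 1) \<le> of_int d" using C2'[of 1 0 1] by simp
  moreover have "real_of_int (f * a - e * b) \<le> of_int b" using C2'[of 0 "-1" 0] by simp
  moreover have "real_of_int (- a) \<le> of_int (f * a - e * b - 1)" using C2'[of 0 "-1" "-1"] by simp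
  ultimately show "admissible a b c d e f"
    unfolding admissible_def using det by (simp only: of_int_le_iff) simp
next
  let ?R = "real_mat (block_mat a b c d e f)"
  assume adm: "admissible a b c d e f"
  then have det: "a * d - b * c = 1" by (simp add: admissible_def)
  then have detr: "real_of_int a * of_int d - of_int b * of_int c = 1"
    by (metis of_int_1 of_int_diff of_int_mult)
  have pos: "0 \<le> real_of_int a" "0 \<le> real_of_int b" "0 \<le> real_of_int c" "0 \<le> real_of_int d"
    "0 \<le> real_of_int e" "0 \<le> real_of_int f"
    using adm by (simp_all add: admissible_def)
  have "real_of_int (e + 1) \<le> of_int (a + c)" "real_of_int (f + 1) \<le> of_int (b + d)"
    "real_of_int (- c) \<le> of_int (f * c - e * d)" "real_of_int (f * c - e * d + 1) \<le> of_int d"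
    "real_of_int (f * a - e * b) \<le> of_int b" "real_of_int (- a) \<le> of_int (f * a - e * b - 1)"
    using adm unfolding of_int_le_iff by (simp_all add: admissible_def)
  then have ineq: "real_of_int e + 1 \<le> a + c" "real_of_int f + 1 \<le> b + d"
    "- real_of_int c \<le> f * c - e * d" "f * c - e * d + 1 \<le> real_of_int d"
    "f * a - e * b \<le> real_of_int b" "- real_of_int a \<le> f * a - e * b - 1"
    by simp_all
  have "?R *v v \<in> C1" if "v \<in> C1" for v
  proof -
    have v: "0 \<le> v$1" "0 \<le> v$2" "0 \<le> v$3" "v$3 \<le> v$1 + v$2"
      using that by (simp_all add: mem_C1_iff)
    \<comment> \<open>As \<open>v$3 \<le> v$1 + v$2\<close>, the third coordinate of the image is at
      most \<open>(e + 1) * v$1 + (f + 1) * v$2\<close>.\<close>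
    show ?thesis
      using mult_right_mono[OF ineq(1) v(1)] mult_right_mono[OF ineq(2) v(2)] v pos
      by (simp add: mem_C1_iff real_block_mat block_mat_vec algebra_simps)
  qed
  moreover have "matrix_inv ?R *v v \<in> C2" if "v \<in> C2" for v
  proof -
    have v: "0 \<le> v$1" "0 \<le> - v$2" "v$2 \<le> v$3" "v$3 \<le> v$1"
      using that by (simp_all add: mem_C2_iff)
    have "0 \<le> d * v$1" "0 \<le> b * (- v$2)" "0 \<le> c * v$1" "0 \<le> a * (- v$2)"
      using pos v by (simp_all only: mult_nonneg_nonneg)
    \<comment> \<open>The bounds are weighted by \<open>v$1\<close> and \<open>- v$2\<close>;
      \<open>v$3 \<le> v$1\<close> serves the upper estimate, \<open>v$2 \<le> v$3\<close> the
      lower.\<close>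
    then show ?thesis
      using mult_right_mono[OF ineq(3) v(1)] mult_right_mono[OF ineq(4) v(1)]
        mult_right_mono[OF ineq(5) v(2)] mult_right_mono[OF ineq(6) v(2)] v
      by (simp add: mem_C2_iff real_block_mat matrix_inv_block_mat[OF detr] block_mat_vec
          algebra_simps)
  qed
  moreover have "?R *v v \<in> C3" if "v \<in> C3" for v
    using that by (simp add: mem_C3_iff real_block_mat block_mat_vec)
  ultimately show "block_mat a b c d e f \<in> cone_monoid"
    using det by (auto simp: cone_monoid_def SL3_int_def det_block_mat)
qed

lemma cone_monoid_block_mat:
  assumes "R \<in> cone_monoid"
  obtains a b c d e f where "R = block_mat a b c d e f"
proof -
  have "vector [0, 0, 1] \<in> C3" by (simp add: mem_C3_iff)
  then have "real_mat R *v vector [0, 0, 1] \<in> C3"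
    using assms by (auto simp: cone_monoid_def)
  then have col: "R$1$3 = 0" "R$2$3 = 0" "0 \<le> R$3$3"
    by (simp_all add: mem_C3_iff matrix_vector_mult_def sum_3)
  \<comment> \<open>Expansion along the last column makes \<open>R$3$3\<close> a nonnegative unit of
    the integers.\<close>
  have "R$3$3 * (R$1$1 * R$2$2 - R$1$2 * R$2$1) = 1"
    using assms col by (simp add: cone_monoid_def SL3_int_def det_3 algebra_simps)
  then have "R$3$3 = 1"
    using col by (metis zmult_eq_1_iff not_one_le_zero neg_0_le_iff_le)
  with col have "R = block_mat (R$1$1) (R$1$2) (R$2$1) (R$2$2) (R$3$1) (R$3$2)"
    by (simp add: vec_eq_iff forall_3 block_mat_nth)
  then show thesis by (rule that)
qed

lemma cone_monoid_eq: "cone_monoid = {block_mat a b c d e f | a b c d e f. admissible a b c d e f}"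
  by (auto simp: block_mat_mem_cone_monoid_iff) (metis block_mat_mem_cone_monoid_iff cone_monoid_block_mat)

subsection \<open>Euclidean descent\<close>

text \<open>Exchanging the two letters, i.e. the first two coordinates, exchanges \<open>G\<close> with \<open>Dt\<close> and
  \<open>Gt\<close> with \<open>D\<close>.\<close>

lemma admissible_swap: "admissible d c b a f e \<longleftrightarrow> admissible a b c d e f"
  by (auto simp: admissible_def algebra_simps)

lemma gen_mat_mult_block_mat:
  "R_G ** block_mat a b c d e f = block_mat (a + c) (b + d) c d e f"
  "R_Gt ** block_mat a b c d e f = block_mat (a + c) (b + d) c d (e + c) (f + d)"
  "R_D ** block_mat a b c d e f = block_mat a b (c + a) (d + b) (e + a) (f + b)"
  "R_Dt ** block_mat a b c d e f = block_mat a b (c + a) (d + b) e f"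
  by (simp_all add: R_G_def R_Gt_def R_D_def R_Dt_def block_mat_mult add.commute
      flip: block_mat_def)

lemma admissible_G: "admissible a b c d e f \<Longrightarrow> admissible (a + c) (b + d) c d e f"
  by (simp add: admissible_def algebra_simps)

text \<open>\<open>e * d - f * c\<close> is unchanged, while \<open>f * a - e * b\<close> loses
  \<open>e * d - f * c\<close> and gains the determinant 1; the strict bound
  \<open>- d < e * d - f * c\<close> leaves room for that 1.\<close>

lemma admissible_Gt: "admissible a b c d e f \<Longrightarrow> admissible (a + c) (b + d) c d (e + c) (f + d)"
  by (simp add: admissible_def algebra_simps)

lemma admissible_gen:
  assumes "admissible a b c d e f"
  shows "gen_mat g ** block_mat a b c d e f \<in> cone_monoid"
  using assms admissible_G[of a b c d e f] admissible_Gt[of a b c d e f]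
    admissible_G[of d c b a f e] admissible_Gt[of d c b a f e]
    admissible_swap[of a b c d e f] admissible_swap[of a b "c + a" "d + b"]
  by (cases g) (simp_all add: gen_mat_mult_block_mat block_mat_mem_cone_monoid_iff)

text \<open>Supplies the bounds on \<open>f * a - e * b\<close>, which a row subtraction alters,
  from those on \<open>e * d - f * c\<close>, which it preserves.\<close>

lemma admissible_bound:
  fixes a b c d e f :: int
  assumes pos: "0 \<le> a" "0 \<le> b" "0 \<le> c" "0 \<le> d" and det: "a * d - b * c = 1"
    and e: "0 \<le> e" and f: "0 \<le> f" "f < b + d"
    and u: "- d < e * d - f * c" "e * d - f * c \<le> c"
  shows "- a < f * a - e * b \<and> f * a - e * b \<le> b"
proof -
  define u where "u = e * d - f * c"
  define n where "n = f * a - e * b"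
  \<comment> \<open>Cramer's rule: (e, f) is \<open>u\<close> times the first row plus
    \<open>n\<close> times the second.\<close>
  have eq: "e = u * a + n * c" "f = u * b + n * d"
    using det unfolding u_def n_def by algebra+
  have d: "0 < d" using pos det mult_nonneg_nonneg[of b c] by (cases "d = 0") auto
  have "- u \<le> d - 1" using u by (simp add: u_def)
  then have "- u * b \<le> (d - 1) * b" using pos by (intro mult_right_mono)
  then have "n * d < (b + 1) * d" using f eq(2) by (simp add: algebra_simps)
  then have "n < b + 1" using d by (simp add: mult_less_cancel_right)
  moreover have "- a < n"
  proof (cases "c = 0")
    case True
    then have "a = 1" "d = 1"
      using det pos by (metis diff_zero mult_zero_right zmult_eq_1_iff not_one_le_zero neg_0_le_iff_le)+
    moreover have "u * b \<le> 0" using u(2) True pos by (simp add: u_def mult_le_0_iff)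
    ultimately show ?thesis using f eq(2) by simp
  next
    case False
    have uc: "u \<le> c" using u by (simp add: u_def)
    then have "u * a \<le> c * a" using pos by (intro mult_right_mono)
    then have "0 \<le> (a + n) * c" using e eq(1) by (simp add: algebra_simps)
    then have "- a \<le> n" using False pos by (simp add: zero_le_mult_iff)
    \<comment> \<open>Cancelling \<open>c\<close> gives only the weak bound; equality would make
      \<open>f\<close> negative.\<close>
    moreover have "n \<noteq> - a"
    proof
      assume n: "n = - a"
      then have "f = (u - c) * b - 1" using eq(2) det by (simp add: algebra_simps)
      moreover have "(u - c) * b \<le> 0" using uc pos by (simp add: mult_le_0_iff)
      ultimately show False using f by simp
    qed
    ultimately show ?thesis by simp
  qed
  ultimately show ?thesis by (simp add: n_def)
qed

text \<open>Excludes that \<open>e\<close> demands the subtraction of the second row from the third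
  while \<open>f\<close> forbids it: \<open>e * d - f * c\<close> would be at least
  \<open>1 + b * c + c\<close>.\<close>

lemma admissible_no_mix1:
  fixes a b c d e f :: int
  assumes pos: "0 \<le> a" "0 \<le> b" "0 \<le> c" "0 \<le> d" and det: "a * d - b * c = 1"
    and u: "e * d - f * c \<le> c" and e: "a + c \<le> e" and f: "f < d"
  shows False
proof -
  have "(a + c) * d \<le> e * d" using e pos by (intro mult_right_mono)
  moreover have "f * c \<le> (d - 1) * c" using f pos by (intro mult_right_mono) auto
  ultimately have "1 + b * c + c \<le> c" using u det by (simp add: algebra_simps)
  moreover have "0 \<le> b * c" using pos by simp
  ultimately show False by simp
qed

text \<open>The opposite conflict would push \<open>e * d - f * c\<close> down to
  \<open>- d - b * c\<close> or below.\<close>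

lemma admissible_no_mix2:
  fixes a b c d e f :: int
  assumes pos: "0 \<le> a" "0 \<le> b" "0 \<le> c" "0 \<le> d" and det: "a * d - b * c = 1"
    and u: "- d < e * d - f * c" and e: "e < c" and f: "b + d \<le> f"
  shows False
proof -
  have "(b + d) * c \<le> f * c" using f pos by (intro mult_right_mono)
  moreover have "e * d \<le> (c - 1) * d" using e pos by (intro mult_right_mono) auto
  moreover have "0 \<le> b * c" using pos by simp
  ultimately show False using u by (simp add: algebra_simps)
qed

lemma admissible_descent:
  assumes adm: "admissible (a + c) (b + d) c d e f" and pos: "0 \<le> a" "0 \<le> b"
  shows "admissible a b c d e f \<or> admissible a b c d (e - c) (f - d)"
proof -
  have cd: "0 \<le> c" "0 \<le> d" and ef: "0 \<le> e" "e < a + c + c" "0 \<le> f" "f < b + d + d"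
    and u: "- d < e * d - f * c" "e * d - f * c \<le> c"
    using adm by (simp_all add: admissible_def)
  have det: "a * d - b * c = 1" using adm by (simp add: admissible_def algebra_simps)
  have u': "- d < (e - c) * d - (f - d) * c" "(e - c) * d - (f - d) * c \<le> c"
    using u by (simp_all add: algebra_simps)
  have "\<not> (a + c \<le> e \<and> f < d)" "\<not> (e < c \<and> b + d \<le> f)"
    using admissible_no_mix1[OF pos cd det u(2)] admissible_no_mix2[OF pos cd det u(1)] by blast+
  \<comment> \<open>Without mixed cases, either both entries are small enough to stay or both are
    large enough to be reduced.\<close>
  then consider "e < a + c" "f < b + d" | "c \<le> e" "d \<le> f"
    using pos by linarith
  then show ?thesis
  proof cases
    case 1
    then have "admissible a b c d e f"
      using admissible_bound[OF pos cd det ef(1,3) 1(2) u] pos cd det ef u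
      by (simp add: admissible_def)
    then show ?thesis ..
  next
    case 2
    then have "admissible a b c d (e - c) (f - d)"
      using admissible_bound[OF pos cd det _ _ _ u'] pos cd det ef u'
      by (simp add: admissible_def)
    then show ?thesis ..
  qed
qed

lemma row_comparison:
  fixes a b c d :: int
  assumes pos: "0 \<le> a" "0 \<le> b" "0 \<le> c" "0 \<le> d" and det: "a * d - b * c = 1"
  obtains "a = 1" "b = 0" "c = 0" "d = 1" | "c \<le> a" "d \<le> b" | "a \<le> c" "b \<le> d"
proof -
  consider "c < a" "b < d" | "a < c" "d < b" | "c \<le> a" "d \<le> b" | "a \<le> c" "b \<le> d"
    by linarith
  then show thesis
  proof cases
    case 1
    \<comment> \<open>These give \<open>1 \<ge> c + d\<close> with \<open>d > 0\<close>, which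
      leaves only the identity.\<close>
    have "(c + 1) * d \<le> a * d" "b * c \<le> (d - 1) * c"
      using 1 pos by (intro mult_right_mono; simp)+
    then have "c = 0" "d = 1" using det 1 pos by (simp_all add: algebra_simps)
    then show thesis using 1 det pos that(1) by simp
  next
    case 2
    have "a * d \<le> c * d" "d * c \<le> b * c"
      using 2 pos by (intro mult_right_mono; simp)+
    then show thesis using det by (simp add: algebra_simps)
  qed (rule that(2,3); assumption)+
qed

subsection \<open>Generated submonoids\<close>

text \<open>Concatenation of lists corresponds to multiplication. The operation is abstract to cover
  both composition of morphisms and matrix products.\<close>

lemma generated_monoid_eq_range_foldr:
  assumes assoc: "\<And>x y z. m (m x y) z = m x (m y z)"
    and unit: "\<And>x. m u x = x" "\<And>x. m x u = x"
  shows "generated_monoid m u (range h) = range (\<lambda>gs. foldr m (map h gs) u)"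
proof
  have app: "foldr m (map h (gs @ hs)) u = m (foldr m (map h gs) u) (foldr m (map h hs) u)" for gs hs
    by (induction gs) (simp_all add: unit assoc)
  show "generated_monoid m u (range h) \<subseteq> range (\<lambda>gs. foldr m (map h gs) u)"
  proof
    fix x assume "x \<in> generated_monoid m u (range h)"
    then show "x \<in> range (\<lambda>gs. foldr m (map h gs) u)"
    proof induction
      case unit
      show ?case by (rule range_eqI[of _ _ "[]"]) simp
    next
      case (incl x)
      then obtain g where "x = h g" by blast
      then show ?case by (intro range_eqI[of _ _ "[g]"]) (simp add: unit)
    next
      case (mult x y)
      then obtain gs hs where "x = foldr m (map h gs) u" "y = foldr m (map h hs) u" by blast
      then have "m x y = foldr m (map h (gs @ hs)) u" using app by simp
      then show ?case by blast
    qed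
  qed
  have "foldr m (map h gs) u \<in> generated_monoid m u (range h)" for gs
    by (induction gs) (auto intro: generated_monoid.intros)
  then show "range (\<lambda>gs. foldr m (map h gs) u) \<subseteq> generated_monoid m u (range h)" by blast
qed

lemma UNIV_gen: "UNIV = {G, Gt, D, Dt}"
  using gen.exhaust by auto

lemma special_sturmian_eq: "special_sturmian = range comp_gens"
proof -
  have "{mor_G, mor_Gt, mor_D, mor_Dt} = range gen_mor" by (simp add: UNIV_gen)
  then show ?thesis
    unfolding special_sturmian_def comp_gens_def
    by (simp only: generated_monoid_eq_range_foldr[of "(\<circ>)" id, OF comp_assoc id_comp comp_id])
qed

lemma generated_matrices_eq:
  "generated_monoid (**) (mat 1) {R_G, R_Gt, R_D, R_Dt} = range prod_gens"
proof -
  have "{R_G, R_Gt, R_D, R_Dt} = range gen_mat" by (simp add: UNIV_gen)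
  then show ?thesis
    unfolding prod_gens_def
    by (simp only: generated_monoid_eq_range_foldr[of "(**)" "mat 1",
          OF matrix_mul_assoc[symmetric] matrix_mul_lid matrix_mul_rid])
qed

section \<open>The two inclusions between generated matrices and the cone monoid\<close>

lemma prod_gens_in_cone_monoid: "prod_gens gs \<in> cone_monoid"
proof (induction gs)
  case Nil
  have "admissible 1 0 0 1 0 0" by (simp add: admissible_def)
  then show ?case
    using block_mat_mem_cone_monoid_iff by (simp add: prod_gens_def flip: block_mat_one)
next
  case (Cons g gs)
  then show ?case using admissible_gen by (auto simp: prod_gens_def cone_monoid_eq)
qed

lemma gen_mat_mult_range:
  assumes "R \<in> range prod_gens"
  shows "gen_mat g ** R \<in> range prod_gens"
proof -
  from assms obtain gs where "R = prod_gens gs" by blast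
  then have "gen_mat g ** R = prod_gens (g # gs)" by (simp add: prod_gens_def)
  then show ?thesis by simp
qed

lemma admissible_in_range:
  "admissible a b c d e f \<Longrightarrow> block_mat a b c d e f \<in> range prod_gens"
proof (induction "nat (a + b + c + d)" arbitrary: a b c d e f rule: less_induct)
  case less
  note adm = less.prems
  then have pos: "0 \<le> a" "0 \<le> b" "0 \<le> c" "0 \<le> d" and det: "a * d - b * c = 1"
    by (simp_all add: admissible_def)
  have "0 \<le> b * c" using pos by simp
  \<comment> \<open>Both rows are thus nonzero, so subtracting either one lowers the sum of the four
    entries.\<close>
  then have "a \<noteq> 0" "d \<noteq> 0" using det by auto
  then have ad: "0 < a" "0 < d" using pos by simp_all
  from pos det show ?case
  proof (cases rule: row_comparison)
    case 1
    then have "e = 0" "f = 0" using adm by (auto simp: admissible_def)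
    with 1 have "block_mat a b c d e f = prod_gens []" by (simp add: block_mat_one prod_gens_def)
    then show ?thesis by simp
  next
    case 2
    have lt: "nat (a - c + (b - d) + c + d) < nat (a + b + c + d)" using pos ad by simp
    have "admissible (a - c) (b - d) c d e f \<or> admissible (a - c) (b - d) c d (e - c) (f - d)"
      using admissible_descent[of "a - c" c "b - d" d e f] adm 2 by simp
    then show ?thesis
    proof
      assume "admissible (a - c) (b - d) c d e f"
      from gen_mat_mult_range[OF less.hyps[OF lt this], of G]
      show ?thesis by (simp add: gen_mat_mult_block_mat)
    next
      assume "admissible (a - c) (b - d) c d (e - c) (f - d)"
      from gen_mat_mult_range[OF less.hyps[OF lt this], of Gt]
      show ?thesis by (simp add: gen_mat_mult_block_mat)
    qed
  next
    case 3
    have lt: "nat (a + b + (c - a) + (d - b)) < nat (a + b + c + d)" using pos ad by simp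
    \<comment> \<open>The descent is applied after exchanging the two letters.\<close>
    have "admissible a b (c - a) (d - b) e f \<or> admissible a b (c - a) (d - b) (e - a) (f - b)"
      using admissible_descent[of "d - b" b "c - a" a f e] adm 3
      by (simp add: admissible_swap)
    then show ?thesis
    proof
      assume "admissible a b (c - a) (d - b) e f"
      from gen_mat_mult_range[OF less.hyps[OF lt this], of Dt]
      show ?thesis by (simp add: gen_mat_mult_block_mat)
    next
      assume "admissible a b (c - a) (d - b) (e - a) (f - b)"
      from gen_mat_mult_range[OF less.hyps[OF lt this], of D]
      show ?thesis by (simp add: gen_mat_mult_block_mat)
    qed
  qed
qed

theorem theorem14:
  shows "cone_monoid = rep ` special_sturmian
       \<and> rep ` special_sturmian = generated_monoid (**) (mat 1) {R_G, R_Gt, R_D, R_Dt}"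
proof -
  have "cone_monoid = range prod_gens"
    using prod_gens_in_cone_monoid admissible_in_range by (auto simp: cone_monoid_eq)
  moreover have "rep ` special_sturmian = range prod_gens"
    by (simp add: special_sturmian_eq image_image rep_comp_gens)
  ultimately show ?thesis by (simp add: generated_matrices_eq)
qed

end
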